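(* The two matrices $$P=\begin{pmatrix}0&-1&0\\0&0&1\\1&0&0\end{pmatrix},\qquad t_{12}=\begin{pmatrix}1&1&0\\0&1&0\\0&0&1\end{pmatrix}$$ form a minimal generating set of $ESL_3(\mathbb{Z})$; that is, they generate $ESL_3(\mathbb{Z})$, and $ESL_3(\mathbb{Z})$ has no generating set with fewer than $2$ elements.
   Context: $ESL_3(\mathbb{Z})$ denotes the group of all $3\times3$ integer matrices with determinant $1$ or $-1$. *)

theory Defs
  imports "HOL-Analysis.Determinants" "HOL-Algebra.Generated_Groups"
begin

definition ESL3 :: "(int^3^3) monoid" where
  "ESL3 = \<lparr>carrier = {A. det A = 1 \<or> det A = -1}, mult = (**), one = mat 1\<rparr>"

definition P :: "int^3^3" where
  "P = vector [vector [0, -1, 0], vector [0, 0, 1], vector [1, 0, 0]]"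

definition t12 :: "int^3^3" where
  "t12 = vector [vector [1, 1, 0], vector [0, 1, 0], vector [0, 0, 1]]"

definition generates :: "('a, 'b) monoid_scheme \<Rightarrow> 'a set \<Rightarrow> bool" where
  "generates G S \<longleftrightarrow> S \<subseteq> carrier G \<and> generate G S = carrier G"

lemma P_in_ESL3: "P \<in> carrier ESL3"
  by (simp add: ESL3_def P_def det_3)

lemma t12_in_ESL3: "t12 \<in> carrier ESL3"
  by (simp add: ESL3_def t12_def det_3)

lemma exists_left_inverse_3:
  fixes A :: "int^3^3"
  assumes "det A = 1 \<or> det A = -1"
  shows "\<exists>B. (det B = 1 \<or> det B = -1) \<and> B ** A = mat 1"
proof -
  define C :: "int^3^3" where "C = vector
    [vector [A$2$2 * A$3$3 - A$2$3 * A$3$2, A$1$3 * A$3$2 - A$1$2 * A$3$3, A$1$2 * A$2$3 - A$1$3 * A$2$2],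
     vector [A$2$3 * A$3$1 - A$2$1 * A$3$3, A$1$1 * A$3$3 - A$1$3 * A$3$1, A$1$3 * A$2$1 - A$1$1 * A$2$3],
     vector [A$2$1 * A$3$2 - A$2$2 * A$3$1, A$1$2 * A$3$1 - A$1$1 * A$3$2, A$1$1 * A$2$2 - A$1$2 * A$2$1]]"
  define B where "B = (\<chi> i j. det A * C $ i $ j)"
  have CA: "C ** A = (\<chi> i j. if i = j then det A else 0)"
    by (simp add: vec_eq_iff forall_3 matrix_matrix_mult_def sum_3 C_def det_3) algebra
  have "B ** A = (\<chi> i j. det A * (C ** A) $ i $ j)"
    by (simp add: B_def matrix_matrix_mult_def sum_distrib_left mult.assoc vec_eq_iff)
  also have "\<dots> = mat 1"
    using assms by (auto simp: CA mat_def vec_eq_iff)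
  finally have BA: "B ** A = mat 1" .
  then have "det B * det A = 1"
    by (metis det_I det_mul)
  then have "det B = 1 \<or> det B = -1"
    using assms by auto
  with BA show ?thesis by blast
qed

lemma group_ESL3: "group ESL3"
proof (rule groupI)
  fix A assume "A \<in> carrier ESL3"
  then show "\<exists>B\<in>carrier ESL3. B \<otimes>\<^bsub>ESL3\<^esub> A = \<one>\<^bsub>ESL3\<^esub>"
    using exists_left_inverse_3[of A] by (auto simp: ESL3_def)
qed (auto simp: ESL3_def det_mul matrix_mul_assoc)

end

theory Submission imports Defs begin

text \<open>
  Conjugation by \<open>P\<close> permutes the elementary matrices \<open>e\<^sub>1\<^sub>2(k)\<close>, \<open>e\<^sub>3\<^sub>1(k)\<close>, \<open>e\<^sub>2\<^sub>3(k)\<close> cyclically up to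
  the sign of \<open>k\<close>, and the commutators of these three families give the remaining three. With all
  elementary matrices available, the Euclidean algorithm on the columns makes a matrix of
  determinant \<open>\<plusminus>1\<close> triangular, and the remaining diagonal signs come from \<open>P\<^sup>3 = -I\<close> and
  from squares of Weyl elements. A generating set with fewer than two elements would make
  the group cyclic, but \<open>P\<close> and \<open>t\<^sub>1\<^sub>2\<close> do not commute.
\<close>

section \<open>Elementary matrices as row operations\<close>

definition elem_mat :: "'n \<Rightarrow> 'n \<Rightarrow> 'a \<Rightarrow> 'a::comm_ring_1^'n^'n" where
  "elem_mat i j k = (\<chi> a b. (if a = b then 1 else 0) + (if a = i \<and> b = j then k else 0))"

lemma elem_mat_mult_nth:
  "(elem_mat i j k ** A) $ a $ b = A $ a $ b + (if a = i then k * A $ j $ b else 0)"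
proof -
  have "(elem_mat i j k ** A) $ a $ b
      = (\<Sum>c\<in>UNIV. (if a = c then A $ c $ b else 0) + (if c = j then if a = i then k * A $ c $ b else 0 else 0))"
    by (auto simp: elem_mat_def matrix_matrix_mult_def distrib_right intro!: sum.cong)
  then show ?thesis
    by (simp add: sum.distrib)
qed

lemma elem_mat_add: "i \<noteq> j \<Longrightarrow> elem_mat i j k ** elem_mat i j l = elem_mat i j (k + l)"
  by (auto simp: vec_eq_iff elem_mat_mult_nth) (auto simp: elem_mat_def)

lemma elem_mat_0: "elem_mat i j 0 = mat 1"
  by (simp add: elem_mat_def mat_def)

lemma elem_mat_cancel: "i \<noteq> j \<Longrightarrow> elem_mat i j (- k) ** (elem_mat i j k ** A) = A"
  by (simp add: matrix_mul_assoc elem_mat_add elem_mat_0)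

lemma det_elem_mat: "i \<noteq> j \<Longrightarrow> det (elem_mat i j k :: int^3^3) = 1"
  using exhaust_3[of i] exhaust_3[of j] by (auto simp: elem_mat_def det_3)

lemma det_elem_mat_mult: "i \<noteq> j \<Longrightarrow> det (elem_mat i j k ** A) = det (A :: int^3^3)"
  by (simp add: det_mul det_elem_mat)

section \<open>Column elimination by the Euclidean algorithm\<close>

text \<open>The new value has absolute value \<open>\<bar>a\<bar> - \<bar>b\<bar>\<close>. One such
  subtraction already makes progress, so no division with remainder is needed.\<close>

lemma abs_add_sgn_mult_less:
  fixes a b :: int
  assumes "a \<noteq> 0" "b \<noteq> 0" "\<bar>b\<bar> \<le> \<bar>a\<bar>"
  shows "\<bar>a + (- sgn a * sgn b) * b\<bar> < \<bar>a\<bar>"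
  using assms by (auto simp: sgn_if abs_if split: if_splits)

text \<open>Subtractive Euclid on the rows in \<open>R\<close>, by induction on the sum of absolute
  values in column \<open>c\<close>. \<open>Q\<close> is an invariant kept by these operations;
  membership in \<open>H\<close> is pulled back along them.\<close>

lemma eliminate_column:
  fixes A :: "int^'n^'n" and H :: "(int^'n^'n) set"
  assumes "Q A"
    and Q: "\<And>A i j k. Q A \<Longrightarrow> i \<in> R \<Longrightarrow> j \<in> R \<Longrightarrow> i \<noteq> j \<Longrightarrow> Q (elem_mat i j k ** A)"
    and H: "\<And>A i j k. i \<noteq> j \<Longrightarrow> elem_mat i j k ** A \<in> H \<Longrightarrow> A \<in> H"
  shows "\<exists>B. Q B \<and> (B \<in> H \<longrightarrow> A \<in> H) \<and> (\<forall>i\<in>R. \<forall>j\<in>R. i \<noteq> j \<longrightarrow> B $ i $ c = 0 \<or> B $ j $ c = 0)"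
  using \<open>Q A\<close>
proof (induction "\<Sum>a\<in>UNIV. nat \<bar>A $ a $ c\<bar>" arbitrary: A rule: less_induct)
  case less
  show ?case
  proof (cases "\<forall>i\<in>R. \<forall>j\<in>R. i \<noteq> j \<longrightarrow> A $ i $ c = 0 \<or> A $ j $ c = 0")
    case True
    then show ?thesis using less.prems by blast
  next
    case False
    then obtain i j where ij: "i \<in> R" "j \<in> R" "i \<noteq> j" "A $ i $ c \<noteq> 0" "A $ j $ c \<noteq> 0"
      and le: "\<bar>A $ j $ c\<bar> \<le> \<bar>A $ i $ c\<bar>"
      by (metis nle_le)
    define k where "k = - sgn (A $ i $ c) * sgn (A $ j $ c)"
    define A' where "A' = elem_mat i j k ** A"
    have lt: "\<bar>A' $ i $ c\<bar> < \<bar>A $ i $ c\<bar>"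
      using abs_add_sgn_mult_less[OF ij(4,5) le] by (simp add: A'_def k_def elem_mat_mult_nth)
    have "(\<Sum>a\<in>UNIV. nat \<bar>A' $ a $ c\<bar>) < (\<Sum>a\<in>UNIV. nat \<bar>A $ a $ c\<bar>)"
    proof (rule sum_strict_mono_ex1)
      show "\<forall>a\<in>UNIV. nat \<bar>A' $ a $ c\<bar> \<le> nat \<bar>A $ a $ c\<bar>"
      proof
        fix a
        show "nat \<bar>A' $ a $ c\<bar> \<le> nat \<bar>A $ a $ c\<bar>"
          using lt by (cases "a = i") (auto simp: A'_def elem_mat_mult_nth)
      qed
      show "\<exists>a\<in>UNIV. nat \<bar>A' $ a $ c\<bar> < nat \<bar>A $ a $ c\<bar>"
        using lt by (intro bexI[of _ i]) auto
    qed simp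
    then obtain B where "Q B" "B \<in> H \<longrightarrow> A' \<in> H"
      "\<forall>i\<in>R. \<forall>j\<in>R. i \<noteq> j \<longrightarrow> B $ i $ c = 0 \<or> B $ j $ c = 0"
      using less.hyps Q[OF less.prems ij(1-3)] unfolding A'_def by metis
    then show ?thesis
      using H[OF ij(3)] unfolding A'_def by blast
  qed
qed

lemma eliminate_column_to_pivot:
  fixes A :: "int^'n^'n" and H :: "(int^'n^'n) set"
  assumes "Q A" and p: "p \<in> R"
    and Q: "\<And>A i j k. Q A \<Longrightarrow> i \<in> R \<Longrightarrow> j \<in> R \<Longrightarrow> i \<noteq> j \<Longrightarrow> Q (elem_mat i j k ** A)"
    and H: "\<And>A i j k. i \<noteq> j \<Longrightarrow> elem_mat i j k ** A \<in> H \<Longrightarrow> A \<in> H"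
  obtains B where "Q B" "B \<in> H \<Longrightarrow> A \<in> H" "\<And>i. i \<in> R \<Longrightarrow> i \<noteq> p \<Longrightarrow> B $ i $ c = 0"
proof -
  have "\<exists>B. Q B \<and> (B \<in> H \<longrightarrow> A \<in> H) \<and>
      (\<forall>i\<in>R. \<forall>j\<in>R. i \<noteq> j \<longrightarrow> B $ i $ c = 0 \<or> B $ j $ c = 0)"
    by (rule eliminate_column) (fact \<open>Q A\<close> Q H)+
  then obtain B where B: "Q B" "B \<in> H \<longrightarrow> A \<in> H"
    "\<forall>i\<in>R. \<forall>j\<in>R. i \<noteq> j \<longrightarrow> B $ i $ c = 0 \<or> B $ j $ c = 0"
    by blast
  show thesis
  proof (cases "\<forall>i\<in>R. i \<noteq> p \<longrightarrow> B $ i $ c = 0")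
    case True
    then show ?thesis using B that by blast
  next
    case False
    then obtain r where r: "r \<in> R" "r \<noteq> p" "B $ r $ c \<noteq> 0" by blast
    \<comment> \<open>Row \<open>p\<close> of \<open>B\<close> is zero in column \<open>c\<close>.
      Adding row \<open>r\<close> to it copies the surviving entry there; subtracting row
      \<open>p\<close> from row \<open>r\<close> then clears the original.\<close>
    define C where "C = elem_mat r p (-1) ** (elem_mat p r 1 ** B)"
    show ?thesis
    proof (rule that[of C])
      show "Q C" using Q B(1) r p unfolding C_def by metis
      show "C \<in> H \<Longrightarrow> A \<in> H" using H B(2) r(2) unfolding C_def by metis
      show "C $ i $ c = 0" if "i \<in> R" "i \<noteq> p" for i
        using that B(3) r p by (auto simp: C_def elem_mat_mult_nth)
    qed
  qed
qed

section \<open>Elementary matrices in the generated subgroup\<close>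

abbreviation ESL3_gen :: "(int^3^3) set" where
  "ESL3_gen \<equiv> generate ESL3 {P, t12}"

lemma ESL3_gen_mult: "A \<in> ESL3_gen \<Longrightarrow> B \<in> ESL3_gen \<Longrightarrow> A ** B \<in> ESL3_gen"
  using generate.eng[of A ESL3 "{P, t12}" B] by (simp add: ESL3_def)

lemma P_in_gen: "P \<in> ESL3_gen" by (simp add: generate.incl)

lemmas mat3_eq_simps =
  vec_eq_iff forall_3 matrix_matrix_mult_def sum_3 mat_def elem_mat_def P_def t12_def

text \<open>Since \<open>P\<close> cubed is \<open>-I\<close>, \<open>P\<close> has order 6 and its
  inverse is its fifth power.\<close>

lemma P_inverse_in_gen: "vector [vector [0, 0, 1], vector [-1, 0, 0], vector [0, 1, 0]] \<in> ESL3_gen"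
proof -
  have "vector [vector [0, 0, 1], vector [-1, 0, 0], vector [0, 1, 0]] = P ** P ** P ** P ** P"
    by (simp add: mat3_eq_simps)
  then show ?thesis by (simp add: ESL3_gen_mult P_in_gen)
qed

lemma t12_eq_elem_mat: "t12 = elem_mat 1 2 1"
  by (simp add: mat3_eq_simps)

lemma elem_mat_12_in_gen: "elem_mat 1 2 k \<in> ESL3_gen"
proof -
  interpret group ESL3 by (rule group_ESL3)
  have "inv\<^bsub>ESL3\<^esub> t12 = elem_mat 1 2 (-1)"
    by (rule inv_equality)
      (auto simp: t12_eq_elem_mat ESL3_def det_elem_mat elem_mat_add elem_mat_0)
  then have minus: "elem_mat 1 2 (-1) \<in> ESL3_gen"
    by (metis generate.inv insertCI)
  have plus: "elem_mat 1 2 1 \<in> ESL3_gen"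
    unfolding t12_eq_elem_mat[symmetric] by (simp add: generate.incl)
  show ?thesis
  proof (induction k rule: int_induct[of _ 0])
    case base
    show ?case using generate.one[of ESL3] by (simp add: elem_mat_0 ESL3_def)
  next
    case (step1 i)
    show ?case using ESL3_gen_mult[OF step1(2) plus] by (simp add: elem_mat_add)
  next
    case (step2 i)
    show ?case using ESL3_gen_mult[OF step2(2) minus] by (simp add: elem_mat_add)
  qed
qed

lemma elem_mat_in_gen:
  assumes "i \<noteq> j"
  shows "elem_mat i j k \<in> ESL3_gen"
proof -
  let ?P' = "vector [vector [0, 0, 1], vector [-1, 0, 0], vector [0, 1, 0]] :: int^3^3"
  note in_gen = ESL3_gen_mult P_in_gen P_inverse_in_gen elem_mat_12_in_gen
  have e31: "elem_mat 3 1 k \<in> ESL3_gen" for k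
  proof -
    have "(elem_mat 3 1 k :: int^3^3) = P ** elem_mat 1 2 (- k) ** ?P'"
      by (simp add: mat3_eq_simps)
    then show ?thesis by (simp add: in_gen)
  qed
  have e23: "elem_mat 2 3 k \<in> ESL3_gen" for k
  proof -
    have "(elem_mat 2 3 k :: int^3^3) = P ** elem_mat 3 1 k ** ?P'"
      by (simp add: mat3_eq_simps)
    then show ?thesis by (simp add: in_gen e31)
  qed
  have e13: "elem_mat 1 3 k \<in> ESL3_gen"
  proof -
    \<comment> \<open>Commutator relation \<open>[e_ij(1), e_jl(k)] = e_il(k)\<close> for distinct
      \<open>i\<close>, \<open>j\<close>, \<open>l\<close>, with inverses written as negated
      parameters.\<close>
    have "(elem_mat 1 3 k :: int^3^3) = elem_mat 1 2 1 ** elem_mat 2 3 k ** elem_mat 1 2 (-1) ** elem_mat 2 3 (- k)"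
      by (simp add: mat3_eq_simps)
    then show ?thesis by (simp add: in_gen e23)
  qed
  have e21: "elem_mat 2 1 k \<in> ESL3_gen"
  proof -
    have "(elem_mat 2 1 k :: int^3^3) = elem_mat 2 3 1 ** elem_mat 3 1 k ** elem_mat 2 3 (-1) ** elem_mat 3 1 (- k)"
      by (simp add: mat3_eq_simps)
    then show ?thesis by (simp add: in_gen e23 e31)
  qed
  have e32: "elem_mat 3 2 k \<in> ESL3_gen"
  proof -
    have "(elem_mat 3 2 k :: int^3^3) = elem_mat 3 1 1 ** elem_mat 1 2 k ** elem_mat 3 1 (-1) ** elem_mat 1 2 (- k)"
      by (simp add: mat3_eq_simps)
    then show ?thesis by (simp add: in_gen e31)
  qed
  show ?thesis
    using assms exhaust_3[of i] exhaust_3[of j] e31 e23 e13 e21 e32 elem_mat_12_in_gen by auto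
qed

text \<open>Discharges the pull-back hypothesis of the elimination lemmas for
  \<open>ESL3_gen\<close>.\<close>

lemma elem_mat_mult_in_genD:
  assumes "i \<noteq> j" "elem_mat i j k ** A \<in> ESL3_gen"
  shows "A \<in> ESL3_gen"
  using ESL3_gen_mult[OF elem_mat_in_gen assms(2)] assms(1) elem_mat_cancel by metis

section \<open>Diagonal and triangular matrices\<close>

lemma sign_diagonal_in_gen:
  fixes a b c :: int
  assumes "\<bar>a\<bar> = 1" "\<bar>b\<bar> = 1" "\<bar>c\<bar> = 1"
  shows "vector [vector [a, 0, 0], vector [0, b, 0], vector [0, 0, c]] \<in> ESL3_gen"
    (is "?D a b c \<in> _")
proof -
  have one: "?D 1 1 1 \<in> ESL3_gen"
  proof -
    have "?D 1 1 1 = elem_mat 1 2 0" by (simp add: mat3_eq_simps)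
    then show ?thesis by (simp add: elem_mat_in_gen)
  qed
  have neg: "?D (-a) (-b) (-c) \<in> ESL3_gen" if "?D a b c \<in> ESL3_gen" for a b c
  proof -
    have "?D (-a) (-b) (-c) = P ** P ** P ** ?D a b c" by (simp add: mat3_eq_simps)
    then show ?thesis by (simp add: ESL3_gen_mult P_in_gen that)
  qed
  \<comment> \<open>\<open>?w i j\<close> is a quarter turn in the plane of coordinates
    \<open>i\<close> and \<open>j\<close>, so its square negates exactly these two. This gives the
    patterns with two minus signs; \<open>neg\<close> supplies those with an odd number.\<close>
  let ?w = "\<lambda>i j. elem_mat i j 1 ** elem_mat j i (-1) ** elem_mat i j 1 :: int^3^3"
  have sq: "?w i j ** ?w i j \<in> ESL3_gen" if "i \<noteq> j" for i j
    using that by (simp add: ESL3_gen_mult elem_mat_in_gen)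
  have "?w 2 3 ** ?w 2 3 = ?D 1 (-1) (-1)" "?w 1 3 ** ?w 1 3 = ?D (-1) 1 (-1)"
    "?w 1 2 ** ?w 1 2 = ?D (-1) (-1) 1"
    by (simp_all add: mat3_eq_simps)
  then have "?D 1 (-1) (-1) \<in> ESL3_gen" "?D (-1) 1 (-1) \<in> ESL3_gen" "?D (-1) (-1) 1 \<in> ESL3_gen"
    using sq[of 2 3] sq[of 1 3] sq[of 1 2] by simp_all
  with one neg[OF one] this[THEN neg] show ?thesis
    using assms by (auto simp: abs_if split: if_splits)
qed

lemma upper_triangular_in_gen:
  assumes "det A = 1 \<or> det A = -1" "A $ 2 $ 1 = 0" "A $ 3 $ 1 = 0" "A $ 3 $ 2 = 0"
  shows "A \<in> ESL3_gen"
proof -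
  define a b c where "a = A $ 1 $ 1" "b = A $ 2 $ 2" "c = A $ 3 $ 3"
  have "\<bar>a * b * c\<bar> = 1" using assms by (auto simp: det_3 a_b_c_def)
  then have abc: "\<bar>a\<bar> = 1" "\<bar>b\<bar> = 1" "\<bar>c\<bar> = 1"
    by (auto simp: abs_mult zmult_eq_1_iff)
  then have sq: "b * b = 1" "c * c = 1" by (auto simp: abs_if split: if_splits)
  let ?x = "A $ 1 $ 2 * b"
  let ?D = "vector [vector [a, 0, 0], vector [0, b, 0], vector [0, 0, c]] :: int^3^3"
  \<comment> \<open>The entries \<open>b\<close> and \<open>c\<close> are their own inverses, so
    multiplying by them replaces division. The term \<open>?x * A $ 2 $ 3\<close> is subtracted in
    advance because the leftmost factor adds it back.\<close>
  let ?B = "elem_mat 1 2 ?x ** (elem_mat 1 3 ((A $ 1 $ 3 - ?x * A $ 2 $ 3) * c) **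
    (elem_mat 2 3 (A $ 2 $ 3 * c) ** ?D))"
  have "A = ?B"
    using assms sq by (simp add: vec_eq_iff forall_3 elem_mat_mult_nth a_b_c_def algebra_simps)
  moreover have "?B \<in> ESL3_gen"
    by (intro ESL3_gen_mult elem_mat_in_gen sign_diagonal_in_gen abc) auto
  ultimately show ?thesis by simp
qed

lemma ESL3_subset_gen:
  assumes "A \<in> carrier ESL3"
  shows "A \<in> ESL3_gen"
proof -
  let ?Q1 = "\<lambda>A :: int^3^3. det A = 1 \<or> det A = -1"
  let ?Q2 = "\<lambda>A :: int^3^3. ?Q1 A \<and> A $ 2 $ 1 = 0 \<and> A $ 3 $ 1 = 0"
  have "?Q1 A" using assms by (simp add: ESL3_def)
  then obtain B where B: "?Q1 B" "B \<in> ESL3_gen \<Longrightarrow> A \<in> ESL3_gen" "\<And>i. i \<in> UNIV \<Longrightarrow> i \<noteq> 1 \<Longrightarrow> B $ i $ 1 = 0"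
    by (rule eliminate_column_to_pivot[of ?Q1 A 1 UNIV ESL3_gen 1])
      (auto simp: det_elem_mat_mult elim: elem_mat_mult_in_genD)
  have "?Q2 B" using B by simp
  \<comment> \<open>Rows 2 and 3 both vanish in column 1, so operations between them preserve the
    zeros already made.\<close>
  then obtain C where C: "?Q2 C" "C \<in> ESL3_gen \<Longrightarrow> B \<in> ESL3_gen" "\<And>i. i \<in> {2, 3} \<Longrightarrow> i \<noteq> 2 \<Longrightarrow> C $ i $ 2 = 0"
    by (rule eliminate_column_to_pivot[of ?Q2 B 2 "{2, 3}" ESL3_gen 2])
      (auto simp: det_elem_mat_mult elem_mat_mult_nth elim: elem_mat_mult_in_genD)
  have "C \<in> ESL3_gen"
    using C(1) C(3)[of 3] by (intro upper_triangular_in_gen) auto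
  then show ?thesis using B(2) C(2) by blast
qed

section \<open>Impossibility of fewer than two generators\<close>

lemma P_t12_not_commute: "P ** t12 \<noteq> t12 ** P"
  by (simp add: mat3_eq_simps)

lemma (in group) generate_singleton_commute:
  assumes "a \<in> carrier G" "x \<in> generate G {a}" "y \<in> generate G {a}"
  shows "x \<otimes> y = y \<otimes> x"
proof -
  obtain m n :: int where "x = a [^] m" "y = a [^] n"
    using assms by (auto simp: generate_pow)
  then show ?thesis
    using assms(1) by (simp flip: int_pow_mult add: add.commute)
qed

lemma ESL3_not_cyclic:
  assumes "finite S" "card S < 2"
  shows "\<not> generates ESL3 S"
proof
  assume gen: "generates ESL3 S"
  interpret group ESL3 by (rule group_ESL3)
  obtain a where a: "a \<in> carrier ESL3" "S \<subseteq> {a}"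
  proof (cases "S = {}")
    case True
    then show ?thesis using that one_closed by blast
  next
    case False
    \<comment> \<open>Finiteness matters here: \<open>card\<close> is 0 on infinite sets as
      well.\<close>
    with assms have "card S = 1" by (simp add: card_gt_0_iff less_2_cases_iff)
    then show ?thesis using that gen by (auto simp: generates_def card_1_singleton_iff)
  qed
  have "carrier ESL3 \<subseteq> generate ESL3 {a}"
    using gen mono_generate[OF a(2)] by (simp add: generates_def)
  then have "P \<otimes>\<^bsub>ESL3\<^esub> t12 = t12 \<otimes>\<^bsub>ESL3\<^esub> P"
    using generate_singleton_commute[OF a(1)] P_in_ESL3 t12_in_ESL3 by blast
  then show False using P_t12_not_commute by (simp add: ESL3_def)
qed

theorem proposition1:
  "generates ESL3 {P, t12} \<and>
   \<not> (\<exists>S. finite S \<and> card S < 2 \<and> generates ESL3 S)"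
proof -
  have "ESL3_gen \<subseteq> carrier ESL3"
    using group.generate_incl[OF group_ESL3] P_in_ESL3 t12_in_ESL3 by simp
  then have "generates ESL3 {P, t12}"
    using ESL3_subset_gen P_in_ESL3 t12_in_ESL3 by (auto simp: generates_def)
  then show ?thesis using ESL3_not_cyclic by blast
qed

end
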